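(* Let $G=(V,E)$ be a connected amply regular graph with parameters $(n,d,\alpha,\beta)$ (with $n=\infty$ allowed), neither complete nor empty, such that $1\ne\beta\ge\alpha$. Then for any $x\in V$ and any integer $i\ge 1$, $$|S_{i+1}(x)|\le\frac{d-\max\left\{\alpha+1,\ i\left(1+\frac12\left\lceil\frac{\alpha(\beta-\alpha)}{\beta-1}\right\rceil\right)\right\}}{\beta+i-1}\,|S_i(x)|,$$ where $S_i(x)$ is the set of vertices at distance $i$ from $x$.
   Context: All graphs are simple and undirected. An amply regular graph with parameters $(n,d,\alpha,\beta)$ is a $d$-regular graph ($d$ finite) with $n$ vertices, $n=\infty$ being allowed, such that any two adjacent vertices have exactly $\alpha$ common neighbors and any two vertices at distance $2$ have exactly $\beta$ common neighbors. Distance is the combinatorial (shortest path) distance. *)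

theory Defs
  imports
    Complex_Main
    "HOL-Library.Extended_Nat"
    "Graph_Theory.Pair_Digraph"
    "Graph_Theory.Digraph_Component"
    "Graph_Theory.Shortest_Path"
begin

text \<open>
  A simple undirected graph, finite or infinite, is a loop-free symmetric digraph whose arcs are
  pairs of vertices: the locale \<^locale>\<open>pair_bidirected_digraph\<close>. Each edge is represented
  by its two orientations, and multiple edges are impossible.
\<close>

definition graph_order :: "'a pair_pre_digraph \<Rightarrow> enat" where
  "graph_order G = (if finite (pverts G) then enat (card (pverts G)) else \<infinity>)"

definition neighbors :: "'a pair_pre_digraph \<Rightarrow> 'a \<Rightarrow> 'a set" where
  "neighbors G x = {y. x \<rightarrow>\<^bsub>with_proj G\<^esub> y}"

text \<open>
  With unit weights the cost of a walk is its length. The distance is \<open>\<infinity>\<close> between different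
  components and whenever one of the arguments is not a vertex.
\<close>

definition graph_dist :: "'a pair_pre_digraph \<Rightarrow> 'a \<Rightarrow> 'a \<Rightarrow> ereal" where
  "graph_dist G x y = wf_digraph.\<mu> (with_proj G) (\<lambda>_. 1) x y"

definition dist_sphere :: "'a pair_pre_digraph \<Rightarrow> nat \<Rightarrow> 'a \<Rightarrow> 'a set" where
  "dist_sphere G i x = {y \<in> pverts G. graph_dist G x y = ereal (real i)}"

definition regular_graph :: "'a pair_pre_digraph \<Rightarrow> nat \<Rightarrow> bool" where
  "regular_graph G d \<longleftrightarrow>
     (\<forall>x\<in>pverts G. finite (neighbors G x) \<and> card (neighbors G x) = d)"

definition amply_regular ::
    "'a pair_pre_digraph \<Rightarrow> enat \<Rightarrow> nat \<Rightarrow> nat \<Rightarrow> nat \<Rightarrow> bool" where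
  "amply_regular G n d \<alpha> \<beta> \<longleftrightarrow>
     pair_bidirected_digraph G \<and>
     graph_order G = n \<and>
     regular_graph G d \<and>
     (\<forall>x\<in>pverts G. \<forall>y\<in>pverts G. x \<rightarrow>\<^bsub>with_proj G\<^esub> y \<longrightarrow>
        card (neighbors G x \<inter> neighbors G y) = \<alpha>) \<and>
     (\<forall>x\<in>pverts G. \<forall>y\<in>pverts G. graph_dist G x y = 2 \<longrightarrow>
        card (neighbors G x \<inter> neighbors G y) = \<beta>)"

definition complete_graph :: "'a pair_pre_digraph \<Rightarrow> bool" where
  "complete_graph G \<longleftrightarrow>
     (\<forall>x\<in>pverts G. \<forall>y\<in>pverts G. x \<noteq> y \<longrightarrow> x \<rightarrow>\<^bsub>with_proj G\<^esub> y)"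

text \<open>An empty graph is one without edges; it may have vertices.\<close>

definition empty_graph :: "'a pair_pre_digraph \<Rightarrow> bool" where
  "empty_graph G \<longleftrightarrow> parcs G = {}"

end

theory Submission
  imports Defs
begin

text \<open>
  Write \<open>f\<close> for the distance to the base point and \<open>N v\<close> for the neighbourhood of \<open>v\<close>. The bound
  is a double count of the edges between two consecutive spheres: a vertex of \<open>S\<^sub>i\<close> has few upper
  neighbours, a vertex of \<open>S\<^sub>i\<^sub>+\<^sub>1\<close> has at least \<open>\<beta> + i - 1\<close> lower ones.

  Few upper neighbours: for an edge \<open>xy\<close>, give a pair \<open>(u, v)\<close> with \<open>u \<in> N x - {y}\<close> and
  \<open>v \<in> N y - {x}\<close> the weight 1 if \<open>u\<close> and \<open>v\<close> are adjacent and \<open>\<beta> - \<alpha>\<close> if \<open>u = v\<close>. All row and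
  column sums equal \<open>\<beta> - 1\<close>, so this is a transport plan between the two neighbourhoods in which
  the mass \<open>\<alpha>(\<beta> - \<alpha>)\<close> does not move. Integrating \<open>f\<close> against it bounds the drop of the Laplacian of
  \<open>f\<close> across \<open>xy\<close>; the ceiling appears because \<open>f\<close> is integral. The drops add up along a geodesic.

  Many lower neighbours: for an edge from \<open>y' \<in> S\<^sub>i\<close> to \<open>y \<in> S\<^sub>i\<^sub>+\<^sub>1\<close>, counting the edges between the
  lower neighbours of \<open>y'\<close> and those of \<open>y\<close> other than \<open>y'\<close> shows that \<open>y\<close> has more lower
  neighbours than \<open>y'\<close>.
\<close>

section \<open>Graphs with a distance layering\<close>

text \<open>The \<open>level\<close> assumptions pin \<open>f\<close> down as the distance from
  \<open>x0\<close> and connect every vertex to \<open>x0\<close>. Distance 2 is expressed through a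
  common neighbour, which keeps walks out of the counting.\<close>

locale layered_amply_regular =
  fixes V :: "'a set" and N :: "'a \<Rightarrow> 'a set" and d \<alpha> \<beta> :: nat
    and x0 :: 'a and f :: "'a \<Rightarrow> nat"
  assumes nbr_in_V: "v \<in> N u \<Longrightarrow> v \<in> V"
    and nbr_sym: "v \<in> N u \<Longrightarrow> u \<in> N v"
    and nbr_irrefl: "u \<notin> N u"
    and nbr_finite: "u \<in> V \<Longrightarrow> finite (N u)"
    and nbr_card: "u \<in> V \<Longrightarrow> card (N u) = d"
    and card_adjacent: "v \<in> N u \<Longrightarrow> card (N u \<inter> N v) = \<alpha>"
    and card_distance2: "w \<in> N u \<Longrightarrow> w \<in> N v \<Longrightarrow> u \<noteq> v \<Longrightarrow> v \<notin> N u \<Longrightarrow> card (N u \<inter> N v) = \<beta>"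
    and level_0: "v \<in> V \<Longrightarrow> f v = 0 \<longleftrightarrow> v = x0"
    and level_adjacent: "v \<in> N u \<Longrightarrow> f v \<le> Suc (f u)"
    and level_pred: "v \<in> V \<Longrightarrow> f v = Suc k \<Longrightarrow> \<exists>u\<in>N v. f u = k"
begin

definition layer :: "nat \<Rightarrow> 'a set" where
  "layer k = {v \<in> V. f v = k}"

definition upper :: "'a \<Rightarrow> 'a set" where
  "upper v = {u \<in> N v. f u = Suc (f v)}"

definition lower :: "'a \<Rightarrow> 'a set" where
  "lower v = {u \<in> N v. Suc (f u) = f v}"

section \<open>Finite layers and positivity of \<beta>\<close>

lemma finite_layer: "finite (layer k)"
proof (induction k)
  case 0
  have "layer 0 \<subseteq> {x0}" by (auto simp: layer_def level_0)
  then show ?case by (rule finite_subset) simp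
next
  case (Suc k)
  have "layer (Suc k) \<subseteq> (\<Union>u\<in>layer k. N u)"
    using level_pred nbr_sym nbr_in_V by (fastforce simp: layer_def)
  moreover have "finite (\<Union>u\<in>layer k. N u)"
    using Suc nbr_finite by (auto simp: layer_def)
  ultimately show ?case by (rule finite_subset)
qed

lemma layer_downward:
  assumes "v \<in> V" "k \<le> f v"
  shows "\<exists>u\<in>V. f u = k"
  using assms
proof (induction "f v - k" arbitrary: v)
  case 0
  then show ?case by auto
next
  case (Suc m)
  then obtain j where j: "f v = Suc j" by (cases "f v") auto
  then obtain u where "u \<in> N v" "f u = j" using level_pred Suc.prems by blast
  then show ?case using Suc j nbr_in_V
    by (metis Suc_diff_le Suc_leI diff_Suc_Suc diff_is_0_eq nat.simps(3) not_less_eq_eq nat.inject)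
qed

text \<open>Descending from level 2 to level 0 gives two vertices at distance 2 with the middle
  vertex as a common neighbour.\<close>

lemma level_2_imp_beta_pos:
  assumes "v \<in> V" "2 \<le> f v"
  shows "\<beta> > 0"
proof -
  obtain w where w: "w \<in> V" "f w = 2" using layer_downward[OF assms] by blast
  then obtain u where u: "u \<in> N w" "f u = 1"
    using level_pred[of w 1] by auto
  then obtain z where z: "z \<in> N u" "f z = 0"
    using level_pred[of u 0] nbr_in_V by auto
  have "w \<notin> N z" using level_adjacent[of w z] w z by auto
  moreover have "w \<noteq> z" using w z by auto
  ultimately have "card (N z \<inter> N w) = \<beta>" using card_distance2 u z nbr_sym by metis
  moreover have "u \<in> N z \<inter> N w" using u z nbr_sym by auto
  moreover have "finite (N z \<inter> N w)" using w nbr_finite by auto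
  ultimately show ?thesis by (metis card_gt_0_iff empty_iff)
qed

section \<open>Counting upper and lower neighbours\<close>

text \<open>A lower neighbour \<open>w\<close> and the \<alpha> common neighbours of
  \<open>v\<close> and \<open>w\<close> are \<alpha> + 1 neighbours of \<open>v\<close>. None is
  upper, as all lie within one step of \<open>w\<close>.\<close>

lemma card_upper_le_triangle:
  assumes v: "v \<in> V" "f v = Suc k"
  shows "card (upper v) + (\<alpha> + 1) \<le> d"
proof -
  obtain w where w: "w \<in> N v" "f w = k" using level_pred[OF v] by blast
  have fin: "finite (N v)" using v nbr_finite by auto
  have disj: "upper v \<inter> insert w (N v \<inter> N w) = {}"
    using v w level_adjacent[of _ w] by (fastforce simp: upper_def)
  have "card (upper v) + (\<alpha> + 1) = card (upper v) + card (insert w (N v \<inter> N w))"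
    using fin card_adjacent[OF w(1)] nbr_irrefl by simp
  also have "\<dots> = card (upper v \<union> insert w (N v \<inter> N w))"
    using fin disj by (intro card_Un_disjoint[symmetric]) (auto simp: upper_def)
  also have "\<dots> \<le> card (N v)"
    using fin w by (intro card_mono) (auto simp: upper_def)
  finally show ?thesis using nbr_card v by simp
qed

lemma card_lower_Suc:
  assumes \<beta>: "\<beta> \<ge> 2" "\<alpha> \<le> \<beta>"
    and y: "y \<in> N y'" "f y = Suc (f y')"
  shows "Suc (card (lower y')) \<le> card (lower y)"
proof -
  define U where "U = lower y'"
  define W where "W = lower y - {y'}"
  have V: "y \<in> V" "y' \<in> V" using y nbr_in_V nbr_sym by blast+
  have y': "y' \<in> N y" using y nbr_sym by blast
  have fin: "finite U" "finite W" "finite (lower y)"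
    using V nbr_finite by (auto simp: U_def W_def lower_def)
  \<comment> \<open>\<open>u\<close> and \<open>y\<close> are at distance 2, and all their common
    neighbours lie on the level of \<open>y'\<close>, so only \<open>y'\<close> is lost.\<close>
  have U_deg: "card {w \<in> W. w \<in> N u} = \<beta> - 1" if u: "u \<in> U" for u
  proof -
    have uy': "y' \<in> N u" "Suc (f u) = f y'" using u nbr_sym by (auto simp: U_def lower_def)
    then have "y \<notin> N u" "u \<noteq> y" using level_adjacent[of y u] y by auto
    then have "card (N u \<inter> N y) = \<beta>" using card_distance2 uy' y' by blast
    moreover have "{w \<in> W. w \<in> N u} = (N u \<inter> N y) - {y'}"
    proof -
      have "f w = f y'" if "w \<in> N u" "w \<in> N y" for w
        using that uy' y level_adjacent[of w u] level_adjacent[of y w] nbr_sym by fastforce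
      then show ?thesis using y by (auto simp: W_def lower_def)
    qed
    moreover have "y' \<in> N u \<inter> N y" using uy' y' by blast
    ultimately show ?thesis by simp
  qed
  \<comment> \<open>Whether or not \<open>w\<close> and \<open>y'\<close> are adjacent, they have at
    most \<beta> common neighbours, since \<alpha> \<le> \<beta>. One of these is \<open>y\<close>,
    which lies above \<open>y'\<close> and so outside \<open>U\<close>.\<close>
  have W_deg: "card {u \<in> U. w \<in> N u} \<le> \<beta> - 1" if w: "w \<in> W" for w
  proof -
    have wy: "w \<in> N y" "w \<noteq> y'" using w by (auto simp: W_def lower_def)
    have finw: "finite (N y' \<inter> N w)" using V nbr_finite by auto
    have "card (N y' \<inter> N w) \<le> \<beta>"
    proof (cases "w \<in> N y'")
      case True
      then show ?thesis using card_adjacent \<beta> by auto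
    next
      case False
      then show ?thesis using card_distance2[of y y' w] wy y nbr_sym by auto
    qed
    moreover have "{u \<in> U. w \<in> N u} \<subseteq> (N y' \<inter> N w) - {y}"
      using y nbr_sym by (auto simp: U_def lower_def)
    then have "card {u \<in> U. w \<in> N u} \<le> card ((N y' \<inter> N w) - {y})"
      using finw by (intro card_mono) auto
    moreover have "y \<in> N y' \<inter> N w" using y wy nbr_sym by auto
    ultimately show ?thesis using finw by simp
  qed
  have "(\<beta> - 1) * card U = (\<Sum>u\<in>U. card {w \<in> W. w \<in> N u})"
    using U_deg by simp
  also have "\<dots> = (\<Sum>w\<in>W. card {u \<in> U. w \<in> N u})"
    using fin by (intro sum_multicount_gen) auto
  also have "\<dots> \<le> (\<Sum>w\<in>W. \<beta> - 1)" using W_deg by (intro sum_mono)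
  finally have "card U \<le> card W" using \<beta> by (simp add: mult.commute)
  moreover have "y' \<in> lower y" using y y' by (simp add: lower_def)
  ultimately show ?thesis unfolding U_def W_def using fin(3)
    by (metis Suc_le_mono card_Suc_Diff1)
qed

text \<open>At level 2 all \<beta> common neighbours with the base point are lower; each further
  level gains one.\<close>

lemma card_lower_ge:
  assumes \<beta>: "\<beta> \<ge> 2" "\<alpha> \<le> \<beta>"
    and "y \<in> V" "f y = Suc (Suc k)"
  shows "\<beta> + k \<le> card (lower y)"
  using assms(3,4)
proof (induction k arbitrary: y)
  case 0
  then obtain u where u: "u \<in> N y" "f u = 1" using level_pred[of y 1] by auto
  then obtain z where z: "z \<in> N u" "f z = 0" using level_pred[of u 0] nbr_in_V by auto
  have "y \<notin> N z" "z \<noteq> y" using level_adjacent[of y z] 0 z by auto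
  then have "card (N z \<inter> N y) = \<beta>" using card_distance2[of u z y] u z nbr_sym by blast
  moreover have "N z \<inter> N y \<subseteq> lower y"
  proof
    fix w assume w: "w \<in> N z \<inter> N y"
    then have "f w \<le> 1" using level_adjacent[of w z] z by auto
    moreover have "f y \<le> Suc (f w)" using level_adjacent[of y w] w nbr_sym by auto
    ultimately show "w \<in> lower y" using w 0 by (auto simp: lower_def)
  qed
  moreover have "finite (lower y)" using nbr_finite 0 by (auto simp: lower_def)
  ultimately show ?case by (metis add_0_right card_mono)
next
  case (Suc k)
  then obtain y' where y': "y' \<in> N y" "f y' = Suc (Suc k)" using level_pred by blast
  then show ?case
    using card_lower_Suc[OF \<beta>, of y y'] Suc nbr_sym[of y' y] nbr_in_V by fastforce
qed

subsection \<open>The Laplacian of the distance function\<close>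

text \<open>A transport plan scaled by \<beta> - 1, which makes all weights integers.\<close>

definition plan :: "'a \<Rightarrow> 'a \<Rightarrow> int" where
  "plan u v = (if v \<in> N u then 1 else 0) + (if u = v then int \<beta> - int \<alpha> else 0)"

lemma plan_sym: "plan u v = plan v u"
  unfolding plan_def using nbr_sym by auto

text \<open>\<open>u\<close> and \<open>y\<close> share the neighbour \<open>x\<close>, so they have
  \<alpha> or \<beta> common neighbours; the - 1 removes \<open>x\<close>.\<close>

lemma adjacency_row_sum:
  assumes xy: "y \<in> N x" and u: "u \<in> N x - {y}"
  shows "(\<Sum>v\<in>N y - {x}. if v \<in> N u then 1 else 0 :: int)
    = int \<beta> - 1 - (if u \<in> N y then int \<beta> - int \<alpha> else 0)"
proof -
  have fin: "finite (N y)" "finite (N u)" using xy u nbr_in_V nbr_finite by auto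
  have "(\<Sum>v\<in>N y - {x}. if v \<in> N u then 1 else 0 :: int) = int (card ((N y - {x}) \<inter> N u))"
    using fin by (simp add: sum.If_cases Int_def)
  also have "(N y - {x}) \<inter> N u = (N u \<inter> N y) - {x}" by auto
  also have "int (card \<dots>) = int (card (N u \<inter> N y)) - 1"
  proof -
    have "x \<in> N u \<inter> N y" using xy u nbr_sym by auto
    then have "Suc (card (N u \<inter> N y - {x})) = card (N u \<inter> N y)"
      using fin by (intro card_Suc_Diff1) auto
    then show ?thesis by linarith
  qed
  also have "card (N u \<inter> N y) = (if u \<in> N y then \<alpha> else \<beta>)"
    using card_adjacent[of y u] card_distance2[of x u y] xy u nbr_sym by auto
  finally show ?thesis by auto
qed

text \<open>The diagonal weight \<beta> - \<alpha> occurs exactly when \<open>u\<close> is adjacent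
  to \<open>y\<close> and makes up for the deficit in that case.\<close>

lemma plan_row_sum:
  assumes xy: "y \<in> N x" and u: "u \<in> N x - {y}"
  shows "(\<Sum>v\<in>N y - {x}. plan u v) = int \<beta> - 1"
proof -
  have "finite (N y)" using xy nbr_in_V nbr_finite by auto
  moreover have "u \<noteq> x" using u nbr_irrefl by auto
  ultimately show ?thesis
    unfolding plan_def sum.distrib adjacency_row_sum[OF xy u] by simp
qed

lemma neighbour_level_sum_diff:
  assumes xy: "y \<in> N x"
  shows "(int \<beta> - 1) * ((\<Sum>u\<in>N x - {y}. int (f u)) - (\<Sum>v\<in>N y - {x}. int (f v)))
    \<le> (int \<beta> - 1) * (int d - 1) - int \<alpha> * (int \<beta> - int \<alpha>)"
proof -
  define P where "P = N x - {y}"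
  define Q where "Q = N y - {x}"
  have yx: "x \<in> N y" using xy nbr_sym by blast
  have V: "x \<in> V" "y \<in> V" using xy yx nbr_in_V by blast+
  have fin: "finite (N x)" "finite (N y)" using V nbr_finite by auto
  have rowP: "(\<Sum>v\<in>Q. plan u v) = int \<beta> - 1" if "u \<in> P" for u
    using plan_row_sum[OF xy] that by (simp add: P_def Q_def)
  \<comment> \<open>Column sums are row sums for the reversed edge.\<close>
  have rowQ: "(\<Sum>u\<in>P. plan u v) = int \<beta> - 1" if "v \<in> Q" for v
    using plan_row_sum[OF yx, of v] that by (simp add: P_def Q_def plan_sym[of _ v])
  have cardP: "int (card P) = int d - 1"
    using card_Suc_Diff1[OF fin(1) xy] nbr_card[OF V(1)] by (simp add: P_def)
  have "(int \<beta> - 1) * (\<Sum>u\<in>P. int (f u)) = (\<Sum>u\<in>P. \<Sum>v\<in>Q. plan u v * int (f u))"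
    by (simp add: sum_distrib_right[symmetric] sum_distrib_left rowP cong: sum.cong)
  moreover have "(int \<beta> - 1) * (\<Sum>v\<in>Q. int (f v)) = (\<Sum>v\<in>Q. \<Sum>u\<in>P. plan u v * int (f v))"
    by (simp add: sum_distrib_right[symmetric] sum_distrib_left rowQ cong: sum.cong)
  moreover have "\<dots> = (\<Sum>u\<in>P. \<Sum>v\<in>Q. plan u v * int (f v))" by (rule sum.swap)
  ultimately have "(int \<beta> - 1) * ((\<Sum>u\<in>P. int (f u)) - (\<Sum>v\<in>Q. int (f v)))
      = (\<Sum>u\<in>P. \<Sum>v\<in>Q. plan u v * (int (f u) - int (f v)))"
    by (simp add: right_diff_distrib sum_subtractf)
  \<comment> \<open>Diagonal mass contributes 0; all other mass moves along edges, where
    \<open>f\<close> changes by at most 1.\<close>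
  also have "\<dots> \<le> (\<Sum>u\<in>P. \<Sum>v\<in>Q. if v \<in> N u then 1 else 0)"
  proof (intro sum_mono)
    fix u v
    show "plan u v * (int (f u) - int (f v)) \<le> (if v \<in> N u then 1 else 0)"
      using level_adjacent[of u v] nbr_sym[of v u] nbr_irrefl[of u] by (auto simp: plan_def)
  qed
  also have "\<dots> = (\<Sum>u\<in>P. int \<beta> - 1 - (if u \<in> N y then int \<beta> - int \<alpha> else 0))"
    using adjacency_row_sum[OF xy] by (simp add: P_def Q_def)
  also have "\<dots> = (int \<beta> - 1) * (int d - 1) - int (card (P \<inter> N y)) * (int \<beta> - int \<alpha>)"
    using fin cardP by (simp add: sum_subtractf sum.If_cases P_def Int_def mult.commute)
  also have "P \<inter> N y = N x \<inter> N y" using nbr_irrefl by (auto simp: P_def)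
  also have "card \<dots> = \<alpha>" using card_adjacent[OF xy] .
  finally show ?thesis by (simp add: P_def Q_def)
qed

abbreviation curv :: int where
  "curv \<equiv> \<lceil>real \<alpha> * (real \<beta> - real \<alpha>) / (real \<beta> - 1)\<rceil>"

definition laplacian :: "'a \<Rightarrow> int" where
  "laplacian v = (\<Sum>u\<in>N v. int (f u)) - int d * int (f v)"

lemma laplacian_drop:
  assumes \<beta>: "\<beta> \<ge> 2" and xy: "y \<in> N x" "f x = Suc (f y)"
  shows "laplacian x \<le> laplacian y - (2 + curv)"
proof -
  define m where "m = (\<Sum>u\<in>N x - {y}. int (f u)) - (\<Sum>v\<in>N y - {x}. int (f v))"
  have "real_of_int ((int \<beta> - 1) * m)
      \<le> real_of_int ((int \<beta> - 1) * (int d - 1) - int \<alpha> * (int \<beta> - int \<alpha>))"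
    using neighbour_level_sum_diff[OF xy(1)] unfolding m_def of_int_le_iff .
  then have "real \<alpha> * (real \<beta> - real \<alpha>) / (real \<beta> - 1) \<le> of_int (int d - 1 - m)"
    using \<beta> by (simp add: field_simps)
  \<comment> \<open>The right-hand side is an integer, so the fraction may be rounded up.\<close>
  then have "curv \<le> int d - 1 - m" by (rule ceiling_le)
  moreover have "x \<in> N y" using xy nbr_sym by blast
  moreover have "finite (N x)" "finite (N y)"
    using xy nbr_sym nbr_in_V nbr_finite by meson+
  \<comment> \<open>The edge itself adds \<open>f y - f x\<close> = -1 and the degree term adds
    \<open>- d\<close>; with \<open>d - 1 - curv\<close> from \<open>m\<close> this leaves
    \<open>- (2 + curv)\<close>.\<close>
  ultimately show ?thesis
    using xy sum.remove[of "N x" y "\<lambda>u. int (f u)"] sum.remove[of "N y" x "\<lambda>u. int (f u)"]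
    by (simp add: laplacian_def m_def algebra_simps)
qed

text \<open>The value at the base point is at most \<open>d\<close>, and each step of a geodesic
  away from it lowers the bound by \<open>2 + curv\<close>.\<close>

lemma laplacian_le:
  assumes \<beta>: "\<beta> \<ge> 2" and "v \<in> V"
  shows "laplacian v \<le> int d - int (f v) * (2 + curv)"
  using assms(2)
proof (induction "f v" arbitrary: v)
  case 0
  have "(\<Sum>u\<in>N v. int (f u)) \<le> (\<Sum>u\<in>N v. 1)"
    using level_adjacent 0 by (intro sum_mono) force
  then show ?case using 0 nbr_card by (simp add: laplacian_def)
next
  case (Suc k)
  then obtain w where w: "w \<in> N v" "f w = k" using level_pred by metis
  then show ?case
    using laplacian_drop[OF \<beta> w(1)] Suc(1)[of w] Suc(2,3) nbr_in_V
    by (fastforce simp: algebra_simps simp flip: Suc(2))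
qed

lemma card_upper_le_curv:
  assumes \<beta>: "\<beta> \<ge> 2" and v: "v \<in> V"
  shows "2 * int (card (upper v)) \<le> 2 * int d - int (f v) * (2 + curv)"
proof -
  have fin: "finite (N v)" using v nbr_finite by auto
  \<comment> \<open>The summand is 2, 1 or 0 on upper, level and lower neighbours, so extending the
    sum to \<open>N v\<close> cannot decrease it.\<close>
  have "2 * int (card (upper v)) = (\<Sum>u\<in>upper v. int (f u) - int (f v) + 1)"
    by (simp add: upper_def)
  also have "\<dots> \<le> (\<Sum>u\<in>N v. int (f u) - int (f v) + 1)"
  proof (rule sum_mono2[OF fin])
    fix u assume "u \<in> N v - upper v"
    then show "0 \<le> int (f u) - int (f v) + 1"
      using level_adjacent[of v u] nbr_sym[of u v] by auto
  qed (auto simp: upper_def)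
  also have "\<dots> = laplacian v + int d"
    using v nbr_card by (simp add: laplacian_def sum.distrib sum_subtractf algebra_simps)
  finally show ?thesis using laplacian_le[OF \<beta> v] by simp
qed

section \<open>Double count between consecutive layers\<close>

lemma card_layer_Suc_le:
  assumes \<beta>: "\<beta> \<ge> 2" "\<alpha> \<le> \<beta>" and "i \<ge> 1"
  shows "real (card (layer (Suc i))) \<le>
    (real d - max (real \<alpha> + 1) (real i * (1 + 1 / 2 * real_of_int curv)))
      / (real \<beta> + real i - 1) * real (card (layer i))"
proof -
  define B where "B = real d - max (real \<alpha> + 1) (real i * (1 + 1 / 2 * real_of_int curv))"
  \<comment> \<open>With \<open>j\<close> = \<open>i - 1\<close>, the bound \<beta> + i - 1 becomes
    \<open>\<beta> + j\<close> without truncated subtraction.\<close>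
  obtain j where j: "i = Suc j" using \<open>i \<ge> 1\<close> by (cases i) auto
  have up: "real (card {z \<in> layer (Suc i). z \<in> N v}) \<le> B" if "v \<in> layer i" for v
  proof -
    have v: "v \<in> V" "f v = i" using that by (auto simp: layer_def)
    have eq: "{z \<in> layer (Suc i). z \<in> N v} = upper v"
      using v nbr_in_V by (auto simp: layer_def upper_def)
    have "real_of_int (2 * int (card (upper v))) \<le> real_of_int (2 * int d - int i * (2 + curv))"
      using card_upper_le_curv[OF \<beta>(1) v(1)] v(2) unfolding of_int_le_iff by simp
    moreover have "real (card (upper v) + (\<alpha> + 1)) \<le> real d"
      using card_upper_le_triangle[of v j] v j unfolding of_nat_le_iff by simp
    ultimately show ?thesis unfolding eq B_def by (simp add: algebra_simps max_def)
  qed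
  have low: "\<beta> + j \<le> card {v \<in> layer i. z \<in> N v}" if "z \<in> layer (Suc i)" for z
  proof -
    have z: "z \<in> V" "f z = Suc (Suc j)" using that j by (auto simp: layer_def)
    have "{v \<in> layer i. z \<in> N v} = lower z"
      using z j nbr_in_V nbr_sym by (auto simp: layer_def lower_def)
    then show ?thesis using card_lower_ge[OF \<beta> z] by simp
  qed
  have "(\<beta> + j) * card (layer (Suc i)) \<le> (\<Sum>z\<in>layer (Suc i). card {v \<in> layer i. z \<in> N v})"
    using sum_mono[of "layer (Suc i)" "\<lambda>_. \<beta> + j", OF low] by (simp add: mult.commute)
  also have "\<dots> = (\<Sum>v\<in>layer i. card {z \<in> layer (Suc i). z \<in> N v})"
    using finite_layer by (intro sum_multicount_gen[symmetric]) auto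
  finally have "real ((\<beta> + j) * card (layer (Suc i)))
      \<le> real (\<Sum>v\<in>layer i. card {z \<in> layer (Suc i). z \<in> N v})"
    by (rule of_nat_mono)
  also have "\<dots> \<le> (\<Sum>v\<in>layer i. B)" unfolding of_nat_sum by (intro sum_mono up)
  finally have "(real \<beta> + real i - 1) * real (card (layer (Suc i))) \<le> B * real (card (layer i))"
    using j by (simp add: mult.commute)
  moreover have "real \<beta> + real i - 1 > 0" using \<beta> \<open>i \<ge> 1\<close> by simp
  ultimately show ?thesis unfolding B_def[symmetric] by (simp add: field_simps)
qed

end

section \<open>The combinatorial distance\<close>

text \<open>A natural-number version of \<open>graph_dist\<close>, meaningful only if
  \<open>y\<close> is reachable from \<open>x\<close>.\<close>

definition hop_dist :: "'a pair_pre_digraph \<Rightarrow> 'a \<Rightarrow> 'a \<Rightarrow> nat" where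
  "hop_dist G x y = (LEAST k. \<exists>p. pre_digraph.awalk (with_proj G) x p y \<and> length p = k)"

lemma neighbors_iff: "y \<in> neighbors G x \<longleftrightarrow> (x, y) \<in> parcs G"
  by (simp add: neighbors_def)

context pair_wf_digraph
begin

lemma hop_dist_le: "awalk x p y \<Longrightarrow> hop_dist G x y \<le> length p"
  unfolding hop_dist_def by (rule Least_le) auto

lemma hop_dist_walk:
  assumes "x \<rightarrow>\<^sup>*\<^bsub>with_proj G\<^esub> y"
  obtains p where "awalk x p y" "length p = hop_dist G x y"
proof -
  obtain p where "awalk x p y" using assms by (auto simp: reachable_awalk)
  then have "\<exists>k p. awalk x p y \<and> length p = k" by blast
  then have "\<exists>p. awalk x p y \<and> length p = hop_dist G x y"
    unfolding hop_dist_def by (rule LeastI_ex)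
  then show thesis using that by blast
qed

lemma graph_dist_hop_dist:
  assumes "x \<rightarrow>\<^sup>*\<^bsub>with_proj G\<^esub> y"
  shows "graph_dist G x y = ereal (real (hop_dist G x y))"
proof -
  have cost: "awalk_cost (\<lambda>_. 1) p = real (length p)" for p
    by (induction p) auto
  obtain p where p: "awalk x p y" "length p = hop_dist G x y" using hop_dist_walk[OF assms] .
  show ?thesis unfolding graph_dist_def \<mu>_def
  proof (rule antisym)
    show "(INF p\<in>{p. awalk x p y}. ereal (awalk_cost (\<lambda>_. 1) p)) \<le> ereal (real (hop_dist G x y))"
      using p by (intro INF_lower2[of p]) (auto simp: cost)
    show "ereal (real (hop_dist G x y)) \<le> (INF p\<in>{p. awalk x p y}. ereal (awalk_cost (\<lambda>_. 1) p))"
      by (intro INF_greatest) (auto simp: cost hop_dist_le)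
  qed
qed

lemma hop_dist_eq_0:
  assumes "x \<rightarrow>\<^sup>*\<^bsub>with_proj G\<^esub> y"
  shows "hop_dist G x y = 0 \<longleftrightarrow> y = x"
proof
  assume "hop_dist G x y = 0"
  then show "y = x" using hop_dist_walk[OF assms] by (metis awalk_Nil_iff length_0_conv)
next
  assume "y = x"
  then have "awalk x [] y" using assms by (auto simp: awalk_Nil_iff reachable_in_verts)
  then show "hop_dist G x y = 0" using hop_dist_le by fastforce
qed

lemma hop_dist_adjacent:
  assumes "x \<rightarrow>\<^sup>*\<^bsub>with_proj G\<^esub> u" "(u, v) \<in> parcs G"
  shows "hop_dist G x v \<le> Suc (hop_dist G x u)"
proof -
  obtain p where p: "awalk x p u" "length p = hop_dist G x u" using hop_dist_walk[OF assms(1)] .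
  have "awalk x (p @ [(u, v)]) v"
    using p(1) arc_implies_awalk[OF assms(2)] by (auto intro: awalk_appendI)
  from hop_dist_le[OF this] show ?thesis using p by simp
qed

text \<open>Dropping the last arc of a shortest walk gives distance at most \<open>k\<close>; a
  smaller value would shorten the way to \<open>v\<close>.\<close>

lemma hop_dist_pred:
  assumes "x \<rightarrow>\<^sup>*\<^bsub>with_proj G\<^esub> v" "hop_dist G x v = Suc k"
  shows "\<exists>u. (u, v) \<in> parcs G \<and> hop_dist G x u = k"
proof -
  obtain p where p: "awalk x p v" "length p = Suc k" using hop_dist_walk[OF assms(1)] assms(2) by metis
  then obtain q u w where q: "p = q @ [(u, w)]" by (cases p rule: rev_cases) auto
  then have "awalk x q u" and uv: "(u, v) \<in> parcs G"
    using p by (auto simp: awalk_simps)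
  then have "x \<rightarrow>\<^sup>*\<^bsub>with_proj G\<^esub> u" and "hop_dist G x u \<le> k"
    using hop_dist_le[of x q u] p q by (auto simp: reachable_awalk)
  then show ?thesis using hop_dist_adjacent[of x u v] uv assms(2) by fastforce
qed

end

section \<open>From connected amply regular graphs to layerings\<close>

lemma layered_amply_regular_hop_dist:
  fixes G :: "'a pair_pre_digraph"
  assumes amply: "amply_regular G n d \<alpha> \<beta>"
    and conn: "Digraph_Component.connected (with_proj G)"
    and x: "x \<in> pverts G"
  shows "layered_amply_regular (pverts G) (neighbors G) d \<alpha> \<beta> x (hop_dist G x)"
    and "layered_amply_regular.layer (pverts G) (hop_dist G x) k = dist_sphere G k x"
proof -
  interpret pair_bidirected_digraph G using amply by (simp add: amply_regular_def)
  \<comment> \<open>Connectedness refers to the symmetric closure, which has the same reachability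
    because the arcs are already symmetric.\<close>
  have reach: "u \<rightarrow>\<^sup>*\<^bsub>with_proj G\<^esub> v" if "u \<in> pverts G" "v \<in> pverts G" for u v
    using conn that reachable_mk_symmetric_eq[OF sym_arcs]
    by (auto simp: connected_def strongly_connected_def)
  have sym: "(v, u) \<in> parcs G" if "(u, v) \<in> parcs G" for u v
    using that arcs_symmetric by blast
  have verts: "u \<in> pverts G" "v \<in> pverts G" if "(u, v) \<in> parcs G" for u v
    using arc_fst_in_verts[OF that] arc_snd_in_verts[OF that] by simp_all
  show lar: "layered_amply_regular (pverts G) (neighbors G) d \<alpha> \<beta> x (hop_dist G x)"
  proof (unfold_locales, unfold neighbors_iff)
    fix w u v
    \<comment> \<open>The walk through \<open>w\<close> bounds the distance by 2, and 0 and 1 are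
      excluded, so the distance-2 clause applies.\<close>
    assume *: "(u, w) \<in> parcs G" "(v, w) \<in> parcs G" "u \<noteq> v" "(u, v) \<notin> parcs G"
    have V: "u \<in> pverts G" "v \<in> pverts G" using * verts by auto
    have ne0: "hop_dist G u v \<noteq> 0" using hop_dist_eq_0[OF reach[OF V]] *(3) by simp
    have "hop_dist G u v \<noteq> 1"
    proof
      assume "hop_dist G u v = 1"
      then obtain t where t: "(t, v) \<in> parcs G" "hop_dist G u t = 0"
        using hop_dist_pred[OF reach[OF V], of 0] by auto
      then have "t = u" using hop_dist_eq_0[OF reach[OF V(1) verts(1)[OF t(1)]]] by simp
      then show False using t * by simp
    qed
    moreover have "hop_dist G u v \<le> 2"
      using hop_dist_adjacent[OF reach[OF V(1) verts(2)[OF *(1)]] sym[OF *(2)]]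
        hop_dist_adjacent[OF reach[OF V(1) V(1)] *(1)] hop_dist_eq_0[OF reach[OF V(1) V(1)]]
      by simp
    ultimately have "hop_dist G u v = 2" using ne0 by linarith
    then have "graph_dist G u v = 2" using graph_dist_hop_dist[OF reach[OF V]] by simp
    then show "card (neighbors G u \<inter> neighbors G v) = \<beta>"
      using amply V by (auto simp: amply_regular_def)
  next
    fix v u assume "(u, v) \<in> parcs G"
    then show "card (neighbors G u \<inter> neighbors G v) = \<alpha>"
      using amply verts by (auto simp: amply_regular_def)
  next
    fix v k assume "v \<in> pverts G" "hop_dist G x v = Suc k"
    then obtain u where "(u, v) \<in> parcs G" "hop_dist G x u = k"
      using hop_dist_pred[OF reach[OF x]] by blast
    then show "\<exists>u\<in>neighbors G v. hop_dist G x u = k"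
      using sym neighbors_iff by metis
  next
    fix v assume "v \<in> pverts G"
    then show "(hop_dist G x v = 0) = (v = x)" using hop_dist_eq_0[OF reach[OF x]] by simp
  next
    fix u v assume "(u, v) \<in> parcs G"
    then show "hop_dist G x v \<le> Suc (hop_dist G x u)" 
      using hop_dist_adjacent[OF reach[OF x verts(1)]] by simp
  next
    fix u v assume "(u, v) \<in> parcs G"
    then show "v \<in> pverts G" "(v, u) \<in> parcs G" using verts sym by blast+
  next
    fix u show "(u, u) \<notin> parcs G" using no_loops' by blast
  next
    fix u assume "u \<in> pverts G"
    then show "finite (neighbors G u)" "card (neighbors G u) = d"
      using amply by (auto simp: amply_regular_def regular_graph_def)
  qed
  interpret L: layered_amply_regular "pverts G" "neighbors G" d \<alpha> \<beta> x "hop_dist G x" by (rule lar)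
  show "L.layer k = dist_sphere G k x"
    using graph_dist_hop_dist[OF reach[OF x]] by (auto simp: L.layer_def dist_sphere_def)
qed

text \<open>In the layering around one vertex of a non-adjacent pair, the other has level at least
  2. Together with \<beta> \<noteq> 1 this yields \<beta> \<ge> 2.\<close>

lemma amply_regular_beta_pos:
  assumes amply: "amply_regular G n d \<alpha> \<beta>"
    and conn: "Digraph_Component.connected (with_proj G)"
    and "\<not> complete_graph G"
  shows "\<beta> > 0"
proof -
  obtain u v where uv: "u \<in> pverts G" "v \<in> pverts G" "u \<noteq> v" "(u, v) \<notin> parcs G"
    using assms(3) by (auto simp: complete_graph_def)
  interpret L: layered_amply_regular "pverts G" "neighbors G" d \<alpha> \<beta> u "hop_dist G u"
    using layered_amply_regular_hop_dist(1)[OF amply conn uv(1)] .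
  have "hop_dist G u v \<noteq> 0" using L.level_0 uv by auto
  moreover have "hop_dist G u v \<noteq> Suc 0"
  proof
    assume "hop_dist G u v = Suc 0"
    then obtain t where t: "t \<in> neighbors G v" "hop_dist G u t = 0"
      using L.level_pred uv by blast
    then have "t = u" using L.level_0 L.nbr_in_V by blast
    then show False using t uv L.nbr_sym by (auto simp: neighbors_iff)
  qed
  ultimately have "2 \<le> hop_dist G u v" by linarith
  then show ?thesis using L.level_2_imp_beta_pos uv by blast
qed

theorem theorem1p8:
  fixes G :: "'a pair_pre_digraph" and n :: enat and d \<alpha> \<beta> i :: nat and x :: 'a
  assumes "amply_regular G n d \<alpha> \<beta>"
    and "Digraph_Component.connected (with_proj G)"
    and "\<not> complete_graph G"
    and "\<not> empty_graph G"
    and "\<beta> \<noteq> 1"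
    and "\<alpha> \<le> \<beta>"
    and "x \<in> pverts G"
    and "i \<ge> 1"
  shows "real (card (dist_sphere G (i + 1) x)) \<le>
    (real d - max (real \<alpha> + 1)
        (real i * (1 + 1 / 2 *
          real_of_int \<lceil>real \<alpha> * (real \<beta> - real \<alpha>) / (real \<beta> - 1)\<rceil>)))
      / (real \<beta> + real i - 1) * real (card (dist_sphere G i x))"
proof -
  interpret L: layered_amply_regular "pverts G" "neighbors G" d \<alpha> \<beta> x "hop_dist G x"
    using layered_amply_regular_hop_dist(1)[OF assms(1,2,7)] .
  have "\<beta> \<ge> 2" using amply_regular_beta_pos[OF assms(1-3)] assms(5) by simp
  then show ?thesis
    using L.card_layer_Suc_le[OF _ assms(6,8)]
    unfolding layered_amply_regular_hop_dist(2)[OF assms(1,2,7)] by simp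
qed

end
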